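(* Let $\alpha\in(0,1)$ and $p\in[1,\infty]$, and assume (Mass regularity) and (Endpoint accuracy at $p$), both stated in the context. Fix $\delta\in(0,1)$ and $n,m\ge 1$ such that $$2\mu_{\rm up}\,\epsilon_p(n,\delta/4)+\eta_m(\delta)\le 2\mu_{\rm low}r_-,\qquad 2\mu_{\rm up}\,\epsilon_p(n,\delta/4)+\eta_m(\delta)+s_m\le 2\mu_{\rm low}r_+ .$$ Then there is an event $\mathcal A_{n,m}(\delta)$, measurable with respect to $(\mathcal D^{\rm tr}_n,\mathcal D^{\rm cal}_m)$, with probability at least $1-\delta$, on which $\widehat Q_{\beta_m}$ is finite and $$\bigl\|\,|\hat{\mathcal C}_\alpha(\cdot)|-|\mathcal C^\star_\alpha(\cdot)|\,\bigr\|_{L^p(P_X)}\le 2\Bigl(1+\frac{\mu_{\rm up}}{\mu_{\rm low}}\Bigr)\epsilon_p(n,\delta/4)+\frac{\eta_m(\delta)+s_m}{\mu_{\rm low}} .$$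
   Context: Generalized inverse: for a nondecreasing right-continuous $H:\mathbb R\to[0,\infty)$ with $\lim_{t\to-\infty}H(t)=0$ and $\tau>0$, $\mathrm Q(\tau;H)=\inf\{t\in\mathbb R:H(t)\ge\tau\}$, with $\inf\varnothing=+\infty$. Setup. $\mathcal X$ is a measurable space, $P_X$ a probability measure on $\mathcal X$, $x\mapsto P_{Y\mid X=x}$ a probability kernel from $\mathcal X$ to $\mathbb R$, and $P_{XY}=P_X\otimes P_{Y\mid X}$. For $\tau\in(0,1)$, $f^\star_\tau(x)=\inf\{t\in\mathbb R: P_{Y\mid X=x}((-\infty,t])\ge\tau\}$. The oracle interval is $\mathcal C^\star_\alpha(x)=[f^\star_{\alpha/2}(x),f^\star_{1-\alpha/2}(x)]$. $|\cdot|$ of a set denotes Lebesgue length. (Mass regularity) There are constants $0<\mu_{\rm low}\le\mu_{\rm up}<\infty$, $r_0>0$ and a measurable set $\mathcal X_0$ with $P_X(\mathcal X_0)=1$ such that for every $x\in\mathcal X_0$: $P_{Y\mid X=x}([u,v])\le\mu_{\rm up}(v-u)$ for all finite $u\le v$; and for $\tau\in\{\alpha/2,1-\alpha/2\}$ and $0\le h\le r_0$, $P_{Y\mid X=x}([f^\star_\tau(x)-h,f^\star_\tau(x)])\ge\mu_{\rm low}h$ and $P_{Y\mid X=x}([f^\star_\tau(x),f^\star_\tau(x)+h])\ge\mu_{\rm low}h$. Samples. $\mathcal D^{\rm tr}_n\sim P_{XY}^{\otimes n}$ and $\mathcal D^{\rm cal}_m=\{(X_i,Y_i)\}_{i=1}^m\sim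 P_{XY}^{\otimes m}$ are independent. The training sample produces finite real-valued raw maps $(\mathcal D^{\rm tr}_n,x)\mapsto\widetilde f_{n,\tau}(x)$, jointly measurable, for $\tau\in\{\alpha/2,1-\alpha/2\}$. (Endpoint accuracy at $p$) There is $\epsilon_p:\mathbb N\times(0,1)\to[0,\infty)$ such that for every $n\in\mathbb N$, $\delta\in(0,1)$, $\tau\in\{\alpha/2,1-\alpha/2\}$: $\mathbb P_{\mathcal D^{\rm tr}_n}(\|\widetilde f_{n,\tau}-f^\star_\tau\|_{L^p(P_X)}\le\epsilon_p(n,\delta))\ge1-\delta$. Split CQR. Sorted endpoints: $\hat f_{n,\alpha/2}=\widetilde f_{n,\alpha/2}\wedge\widetilde f_{n,1-\alpha/2}$, $\hat f_{n,1-\alpha/2}=\widetilde f_{n,\alpha/2}\vee\widetilde f_{n,1-\alpha/2}$ (pointwise). Fitted score: $\widehat S(x,y)=\max\{\hat f_{n,\alpha/2}(x)-y,\;y-\hat f_{n,1-\alpha/2}(x)\}$. Empirical score CDF: $\widehat F_m(t)=\frac1m\sum_{i=1}^m\mathbf 1\{\widehat S(X_i,Y_i)\le t\}$. Level $\beta_m=\lceil(m+1)(1-\alpha)\rceil/m$, threshold $\widehat Q_{\beta_m}=\mathrm Q(\beta_m;\widehat F_m)$, prediction set $\hat{\mathcal C}_\alpha(x)=\{y\in\mathbb R:\widehat S(x,y)\le\widehat Q_{\beta_m}\}$ (possibly empty, or $\mathbb R$). Scales: $s_m=\beta_m-(1-\alpha)$, $\eta_m(\delta)=\sqrt{\log(4/\delta)/(2m)}$,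 $r_-=r_0\wedge\frac{1-\alpha}{2\mu_{\rm up}}$, $r_+=r_0$. *)

theory Defs
  imports "HOL-Probability.Probability"
begin

(* The value is an extended real so that the infimum of the empty set is +oo. *)
definition gen_inverse :: "real \<Rightarrow> (real \<Rightarrow> real) \<Rightarrow> ereal" where
  "gen_inverse \<tau> H = (INF t\<in>{t. H t \<ge> \<tau>}. ereal t)"

(* Full L^p norm for p in [1, oo]; functions that are not measurable, or not in L^p,
   have norm oo. For p = oo it is the essential supremum of the absolute value. *)
definition Lp_norm :: "'a measure \<Rightarrow> ennreal \<Rightarrow> ('a \<Rightarrow> real) \<Rightarrow> ennreal" where
  "Lp_norm M p f =
    (if f \<notin> borel_measurable M then \<infinity>
     else if p = \<infinity> then esssup M (\<lambda>x. ennreal \<bar>f x\<bar>)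
     else if integrable M (\<lambda>x. \<bar>f x\<bar> powr enn2real p)
       then ennreal ((\<integral>x. \<bar>f x\<bar> powr enn2real p \<partial>M) powr (1 / enn2real p))
     else \<infinity>)"

definition joint_law :: "'a measure \<Rightarrow> ('a \<Rightarrow> real measure) \<Rightarrow> ('a \<times> real) measure" where
  "joint_law PX K = PX \<bind> (\<lambda>x. K x \<bind> (\<lambda>y. return (PX \<Otimes>\<^sub>M borel) (x, y)))"

definition sample_law ::
    "'a measure \<Rightarrow> ('a \<Rightarrow> real measure) \<Rightarrow> nat \<Rightarrow> (nat \<Rightarrow> 'a \<times> real) measure" where
  "sample_law PX K n = (\<Pi>\<^sub>M i\<in>{1..n}. joint_law PX K)"

(* For 0 < \<tau> < 1 and K x a probability measure the set is nonempty and bounded below,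
   so this is a genuine real infimum. *)
definition oracle_quantile :: "('a \<Rightarrow> real measure) \<Rightarrow> real \<Rightarrow> 'a \<Rightarrow> real" where
  "oracle_quantile K \<tau> x = Inf {t. cdf (K x) t \<ge> \<tau>}"

definition oracle_interval :: "('a \<Rightarrow> real measure) \<Rightarrow> real \<Rightarrow> 'a \<Rightarrow> real set" where
  "oracle_interval K \<alpha> x = {oracle_quantile K (\<alpha>/2) x .. oracle_quantile K (1 - \<alpha>/2) x}"

definition mass_regularity ::
    "'a measure \<Rightarrow> ('a \<Rightarrow> real measure) \<Rightarrow> real \<Rightarrow> real \<Rightarrow> real \<Rightarrow> real \<Rightarrow> bool" where
  "mass_regularity PX K \<alpha> \<mu>low \<mu>up r0 \<longleftrightarrow>
    0 < \<mu>low \<and> \<mu>low \<le> \<mu>up \<and> 0 < r0 \<and>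
    (\<exists>X0\<in>sets PX. measure PX X0 = 1 \<and>
      (\<forall>x\<in>X0.
        (\<forall>u v. u \<le> v \<longrightarrow> measure (K x) {u..v} \<le> \<mu>up * (v - u)) \<and>
        (\<forall>\<tau>\<in>{\<alpha>/2, 1 - \<alpha>/2}. \<forall>h. 0 \<le> h \<and> h \<le> r0 \<longrightarrow>
          measure (K x) {oracle_quantile K \<tau> x - h .. oracle_quantile K \<tau> x} \<ge> \<mu>low * h \<and>
          measure (K x) {oracle_quantile K \<tau> x .. oracle_quantile K \<tau> x + h} \<ge> \<mu>low * h)))"

(* ft n d \<tau> is the raw map of level \<tau> fitted on the training sample d of size n. *)
definition raw_maps_measurable ::
    "'a measure \<Rightarrow> ('a \<Rightarrow> real measure) \<Rightarrow> real \<Rightarrow>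
      (nat \<Rightarrow> (nat \<Rightarrow> 'a \<times> real) \<Rightarrow> real \<Rightarrow> 'a \<Rightarrow> real) \<Rightarrow> bool" where
  "raw_maps_measurable PX K \<alpha> ft \<longleftrightarrow>
    (\<forall>n\<ge>1. \<forall>\<tau>\<in>{\<alpha>/2, 1 - \<alpha>/2}.
      (\<lambda>(d, x). ft n d \<tau> x) \<in> borel_measurable (sample_law PX K n \<Otimes>\<^sub>M PX))"

definition endpoint_accuracy ::
    "'a measure \<Rightarrow> ('a \<Rightarrow> real measure) \<Rightarrow> real \<Rightarrow> ennreal \<Rightarrow>
      (nat \<Rightarrow> (nat \<Rightarrow> 'a \<times> real) \<Rightarrow> real \<Rightarrow> 'a \<Rightarrow> real) \<Rightarrow> (nat \<Rightarrow> real \<Rightarrow> real) \<Rightarrow> bool" where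
  "endpoint_accuracy PX K \<alpha> p ft \<epsilon> \<longleftrightarrow>
    (\<forall>n\<ge>1. \<forall>\<delta>\<in>{0<..<1}. 0 \<le> \<epsilon> n \<delta> \<and>
      (\<forall>\<tau>\<in>{\<alpha>/2, 1 - \<alpha>/2}.
        measure (sample_law PX K n)
          {d \<in> space (sample_law PX K n).
            Lp_norm PX p (\<lambda>x. ft n d \<tau> x - oracle_quantile K \<tau> x) \<le> ennreal (\<epsilon> n \<delta>)}
        \<ge> 1 - \<delta>))"

(* From here on, g \<tau> is the fitted raw map of level \<tau> (the training sample being fixed),
   and D is a calibration sample of size m. *)
definition lower_endpoint :: "real \<Rightarrow> (real \<Rightarrow> 'a \<Rightarrow> real) \<Rightarrow> 'a \<Rightarrow> real" where
  "lower_endpoint \<alpha> g x = min (g (\<alpha>/2) x) (g (1 - \<alpha>/2) x)"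

definition upper_endpoint :: "real \<Rightarrow> (real \<Rightarrow> 'a \<Rightarrow> real) \<Rightarrow> 'a \<Rightarrow> real" where
  "upper_endpoint \<alpha> g x = max (g (\<alpha>/2) x) (g (1 - \<alpha>/2) x)"

definition cqr_score :: "real \<Rightarrow> (real \<Rightarrow> 'a \<Rightarrow> real) \<Rightarrow> 'a \<Rightarrow> real \<Rightarrow> real" where
  "cqr_score \<alpha> g x y = max (lower_endpoint \<alpha> g x - y) (y - upper_endpoint \<alpha> g x)"

definition empirical_score_cdf ::
    "real \<Rightarrow> (real \<Rightarrow> 'a \<Rightarrow> real) \<Rightarrow> nat \<Rightarrow> (nat \<Rightarrow> 'a \<times> real) \<Rightarrow> real \<Rightarrow> real" where
  "empirical_score_cdf \<alpha> g m D t =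
    (\<Sum>i=1..m. of_bool (cqr_score \<alpha> g (fst (D i)) (snd (D i)) \<le> t)) / real m"

definition cqr_level :: "real \<Rightarrow> nat \<Rightarrow> real" where
  "cqr_level \<alpha> m = real_of_int \<lceil>(real m + 1) * (1 - \<alpha>)\<rceil> / real m"

definition cqr_threshold ::
    "real \<Rightarrow> (real \<Rightarrow> 'a \<Rightarrow> real) \<Rightarrow> nat \<Rightarrow> (nat \<Rightarrow> 'a \<times> real) \<Rightarrow> ereal" where
  "cqr_threshold \<alpha> g m D = gen_inverse (cqr_level \<alpha> m) (empirical_score_cdf \<alpha> g m D)"

(* Empty or all of the reals if the threshold is infinite; for a finite threshold it is
   bounded, so that its length is finite and given by measure lborel. *)
definition cqr_set ::
    "real \<Rightarrow> (real \<Rightarrow> 'a \<Rightarrow> real) \<Rightarrow> nat \<Rightarrow> (nat \<Rightarrow> 'a \<times> real) \<Rightarrow> 'a \<Rightarrow> real set" where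
  "cqr_set \<alpha> g m D x = {y. ereal (cqr_score \<alpha> g x y) \<le> cqr_threshold \<alpha> g m D}"

definition level_excess :: "real \<Rightarrow> nat \<Rightarrow> real" where
  "level_excess \<alpha> m = cqr_level \<alpha> m - (1 - \<alpha>)"

definition deviation_scale :: "nat \<Rightarrow> real \<Rightarrow> real" where
  "deviation_scale m \<delta> = sqrt (ln (4 / \<delta>) / (2 * real m))"

end

theory Submission
  imports Defs
begin

text \<open>
  Two deterministic facts reduce the length error to a bound on the threshold. If the threshold is a
  real number $Q$, the prediction set is the fitted interval widened by $Q$ on both sides (narrowed if
  $Q < 0$), so its length differs from the oracle length by at most the two endpoint errors plus
  $2 |Q|$ (\<open>length_error_Lp\<close>). By Minkowski's inequality (\<open>Lp_norm_triangle\<close>) the $L^p$ error is then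
  at most $2 \<epsilon> + 2 |Q|$.

  To bound $Q$, let $F$ be the score distribution function of the fitted interval on the population.
  The oracle interval covers exactly $1 - \<alpha>$; the lower mass bound turns a widening by $t$ into
  additional coverage $2 \<mu>_{low} t$, and the upper mass bound limits the effect of the endpoint errors to
  $2 \<mu>_{up} \<epsilon>$ on average, since $L^1$ norms are below $L^p$ norms. Hence
  $F(t) \<ge> 1 - \<alpha> + 2 \<mu>_{low} t - 2 \<mu>_{up} \<epsilon>$ and
  $F(-t) \<le> 1 - \<alpha> - 2 \<mu>_{low} t + 2 \<mu>_{up} \<epsilon>$ (\<open>score_cdf_bounds\<close>). With $\<eta>$ the sampling deviation and $s$
  the excess of the level $\<beta> = 1 - \<alpha> + s$, take
  $a = (2 \<mu>_{up} \<epsilon> + \<eta>) / (2 \<mu>_{low})$ and $b = a + s / (2 \<mu>_{low})$. Then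
  $F(-a) + \<eta> \<le> 1 - \<alpha> < \<beta>$ and $F(b) \<ge> \<beta> + \<eta>$. The two smallness hypotheses say exactly that $a$ and
  $b$ lie in the range where the mass bounds apply.

  Since $a$ and $b$ do not depend on the calibration sample, a uniform deviation inequality for the
  empirical distribution function can be avoided: two one-sided Hoeffding bounds, each failing with
  probability at most $\<delta> / 4$, place the empirical value below $\<beta>$ at $-a$ and at or above $\<beta>$ at $b$
  (\<open>calibration_event\<close>). Then $-a \<le> Q \<le> b$, so $2 |Q| \<le> 2 b$, which is the claimed bound. The two
  endpoint accuracy events cost another $\<delta> / 4$ each, and independence of the two samples combines
  both stages (\<open>measure_pair_ge\<close>).
\<close>

section \<open>Bounds on the $L^p$ norm\<close>

text \<open>
  Convexity of the power function up to and including the boundary point $0$, where it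
  amounts to $v^r \<le> v$ for $0 < v < 1$.
\<close>

lemma powr_convex_nonneg:
  fixes a b r w :: real
  assumes "0 \<le> a" "0 \<le> b" "1 \<le> r" "0 < w" "w < 1"
  shows "(w * a + (1 - w) * b) powr r \<le> w * a powr r + (1 - w) * b powr r"
proof -
  have shrink: "(v * c) powr r \<le> v * c powr r" if "0 < v" "v < 1" "0 \<le> c" for v c :: real
  proof -
    have "v powr r \<le> v powr 1"
      using that assms by (intro powr_mono') auto
    then show ?thesis
      using that by (simp add: powr_mult mult_right_mono)
  qed
  consider "a = 0" | "b = 0" | "a > 0" "b > 0"
    using assms by linarith
  then show ?thesis
  proof cases
    case 3
    have "convex_on {0<..} (\<lambda>x::real. x powr r)"
      by (rule powr_convex) fact
    from convex_onD[OF this, of "1 - w" a b] 3 assms show ?thesis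
      by simp
  qed (use shrink[of "1 - w" b] shrink[of w a] assms in simp_all)
qed

lemma Lp_norm_le_iff_finite:
  assumes "1 \<le> p" "p \<noteq> \<infinity>" "0 \<le> c"
  shows "Lp_norm M p f \<le> ennreal c \<longleftrightarrow>
    f \<in> borel_measurable M \<and> integrable M (\<lambda>x. \<bar>f x\<bar> powr enn2real p) \<and>
    (\<integral>x. \<bar>f x\<bar> powr enn2real p \<partial>M) \<le> c powr enn2real p"
proof -
  define r where "r = enn2real p"
  have r: "1 \<le> r"
    using assms unfolding r_def by (cases p) auto
  have "I powr (1 / r) \<le> c \<longleftrightarrow> I \<le> c powr r" if "0 \<le> I" for I
  proof
    assume "I powr (1 / r) \<le> c"
    then have "(I powr (1 / r)) powr r \<le> c powr r"
      using r by (intro powr_mono2) auto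
    then show "I \<le> c powr r"
      using r that by (simp add: powr_powr)
  next
    assume "I \<le> c powr r"
    then have "I powr (1 / r) \<le> (c powr r) powr (1 / r)"
      using r that by (intro powr_mono2) auto
    then show "I powr (1 / r) \<le> c"
      using r \<open>0 \<le> c\<close> by (simp add: powr_powr)
  qed
  moreover have "0 \<le> (\<integral>x. \<bar>f x\<bar> powr r \<partial>M)"
    by (rule integral_nonneg_AE) simp
  ultimately show ?thesis
    using assms unfolding Lp_norm_def r_def[symmetric] by (auto simp: top_unique)
qed

lemma Lp_norm_le_iff_infinity:
  assumes "0 \<le> c"
  shows "Lp_norm M top f \<le> ennreal c \<longleftrightarrow> f \<in> borel_measurable M \<and> (AE x in M. \<bar>f x\<bar> \<le> c)"
proof (cases "f \<in> borel_measurable M")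
  case [measurable]: True
  have "esssup M (\<lambda>x. ennreal \<bar>f x\<bar>) \<le> ennreal c \<longleftrightarrow> (AE x in M. ennreal \<bar>f x\<bar> \<le> ennreal c)"
  proof
    assume *: "esssup M (\<lambda>x. ennreal \<bar>f x\<bar>) \<le> ennreal c"
    show "AE x in M. ennreal \<bar>f x\<bar> \<le> ennreal c"
      using esssup_AE[of "\<lambda>x. ennreal \<bar>f x\<bar>" M] by eventually_elim (rule order_trans[OF _ *])
  qed (rule esssup_I, auto)
  then show ?thesis
    using assms True by (simp add: Lp_norm_def)
qed (simp add: Lp_norm_def top_unique)

text \<open>
  Minkowski's inequality. With $w = A / (A + B)$, the function $(|f| + |g|) / (A + B)$ is the
  convex combination of $|f| / A$ and $|g| / B$ with weights $w$ and $1 - w$. Each of these has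
  norm at most $1$, and by convexity of the $r$-th power so has the combination. Stating the
  bound for any measurable \<open>h\<close> dominated by $|f| + |g|$ includes the monotonicity of the norm.
\<close>

lemma Lp_norm_triangle_pos:
  assumes p: "1 \<le> p" and A: "0 < A" and B: "0 < B"
    and f: "Lp_norm M p f \<le> ennreal A" and g: "Lp_norm M p g \<le> ennreal B"
    and h [measurable]: "h \<in> borel_measurable M"
    and dom: "AE x in M. \<bar>h x\<bar> \<le> \<bar>f x\<bar> + \<bar>g x\<bar>"
  shows "Lp_norm M p h \<le> ennreal (A + B)"
proof (cases "p = \<infinity>")
  case True
  have "AE x in M. \<bar>f x\<bar> \<le> A" "AE x in M. \<bar>g x\<bar> \<le> B"
    using f g A B True by (simp_all add: Lp_norm_le_iff_infinity)
  with dom have "AE x in M. \<bar>h x\<bar> \<le> A + B"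
    by eventually_elim linarith
  then show ?thesis
    using A B True by (simp add: Lp_norm_le_iff_infinity del: ennreal_plus)
next
  case False
  define r where "r = enn2real p"
  have r: "1 \<le> r"
    using p False unfolding r_def by (cases p) auto
  note iff = Lp_norm_le_iff_finite[OF p False, folded r_def]
  have F: "integrable M (\<lambda>x. \<bar>f x\<bar> powr r)" "(\<integral>x. \<bar>f x\<bar> powr r \<partial>M) \<le> A powr r"
    using f A by (simp_all add: iff)
  have G: "integrable M (\<lambda>x. \<bar>g x\<bar> powr r)" "(\<integral>x. \<bar>g x\<bar> powr r \<partial>M) \<le> B powr r"
    using g B by (simp_all add: iff)
  define w where "w = A / (A + B)"
  have w: "0 < w" "w < 1" "1 - w = B / (A + B)"
    using A B by (simp_all add: w_def field_simps)
  have wA: "(A + B) * w = A" and wB: "(A + B) * (1 - w) = B"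
    using A B unfolding w(3) by (simp_all add: w_def)
  \<comment> \<open>The integrable majorant of $|h|^r$ that convexity provides.\<close>
  define k where "k = (\<lambda>x. (A + B) powr r *
    (w * (\<bar>f x\<bar> powr r / A powr r) + (1 - w) * (\<bar>g x\<bar> powr r / B powr r)))"
  have k_int: "integrable M k"
    unfolding k_def using F G by (intro integrable_mult_right Bochner_Integration.integrable_add) auto
  have hk: "AE x in M. \<bar>h x\<bar> powr r \<le> k x"
    using dom
  proof eventually_elim
    case (elim x)
    have "\<bar>h x\<bar> powr r \<le> (\<bar>f x\<bar> + \<bar>g x\<bar>) powr r"
      using elim r by (intro powr_mono2) auto
    also have "\<bar>f x\<bar> + \<bar>g x\<bar> = (A + B) * (w * (\<bar>f x\<bar> / A) + (1 - w) * (\<bar>g x\<bar> / B))"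
      using A B wA wB by (simp add: distrib_left flip: mult.assoc)
    also have "\<dots> powr r = (A + B) powr r * (w * (\<bar>f x\<bar> / A) + (1 - w) * (\<bar>g x\<bar> / B)) powr r"
      by (intro powr_mult)
    also have "\<dots> \<le> (A + B) powr r * (w * (\<bar>f x\<bar> / A) powr r + (1 - w) * (\<bar>g x\<bar> / B) powr r)"
      using A B w r by (intro mult_left_mono powr_convex_nonneg) auto
    also have "\<dots> = k x"
      using A B by (simp add: k_def powr_divide)
    finally show ?case .
  qed
  have h_int: "integrable M (\<lambda>x. \<bar>h x\<bar> powr r)"
    using hk by (intro Bochner_Integration.integrable_bound[OF k_int]) (auto elim: eventually_mono)
  have "(\<integral>x. \<bar>h x\<bar> powr r \<partial>M) \<le> (\<integral>x. k x \<partial>M)"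
    by (rule integral_mono_AE) fact+
  also have "\<dots> = (A + B) powr r * (w * ((\<integral>x. \<bar>f x\<bar> powr r \<partial>M) / A powr r)
      + (1 - w) * ((\<integral>x. \<bar>g x\<bar> powr r \<partial>M) / B powr r))"
    unfolding k_def using F G by simp
  also have "\<dots> \<le> (A + B) powr r * (w * 1 + (1 - w) * 1)"
    using A B w F G by (intro mult_left_mono add_mono) auto
  finally show ?thesis
    using h_int A B by (simp add: iff del: ennreal_plus)
qed

text \<open>
  A bound that vanishes cannot be divided by; each bound is enlarged by $e / 2$ and then
  $e \<rightarrow> 0$.
\<close>

lemma Lp_norm_triangle:
  assumes p: "1 \<le> p" and A: "0 \<le> A" and B: "0 \<le> B"
    and f: "Lp_norm M p f \<le> ennreal A" and g: "Lp_norm M p g \<le> ennreal B"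
    and h: "h \<in> borel_measurable M"
    and dom: "AE x in M. \<bar>h x\<bar> \<le> \<bar>f x\<bar> + \<bar>g x\<bar>"
  shows "Lp_norm M p h \<le> ennreal (A + B)"
proof (rule ennreal_le_epsilon)
  fix e :: real assume e: "0 < e"
  have "Lp_norm M p h \<le> ennreal ((A + e / 2) + (B + e / 2))"
  proof (rule Lp_norm_triangle_pos[OF p _ _ _ _ h dom])
    show "Lp_norm M p f \<le> ennreal (A + e / 2)"
      using f by (rule order_trans) (use e in \<open>auto intro: ennreal_leI\<close>)
    show "Lp_norm M p g \<le> ennreal (B + e / 2)"
      using g by (rule order_trans) (use e in \<open>auto intro: ennreal_leI\<close>)
  qed (use A B e in auto)
  also have "\<dots> = ennreal (A + B) + ennreal e"
    using A B e by (simp flip: ennreal_plus)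
  finally show "Lp_norm M p h \<le> ennreal (A + B) + ennreal e" .
qed

lemma (in prob_space) Lp_norm_const_le:
  assumes "1 \<le> p" "0 \<le> c"
  shows "Lp_norm M p (\<lambda>_. c) \<le> ennreal c"
proof (cases "p = \<infinity>")
  case True
  then show ?thesis
    using assms by (simp add: Lp_norm_le_iff_infinity)
next
  case False
  then show ?thesis
    using assms by (simp add: Lp_norm_le_iff_finite prob_space)
qed

text \<open>
  On a probability space the $L^1$ norm is dominated by the $L^p$ norm. For finite $p$ this is
  Jensen's inequality for the power function. It is applied to $|f| + 1$ instead of $|f|$, since
  this variable stays in the open half-line on which Jensen's inequality is formulated; both
  sides then carry the same surplus $1$, by the triangle inequality.
\<close>

lemma (in prob_space) expectation_abs_le_Lp_norm:
  assumes p: "1 \<le> p" and A: "0 \<le> A" and f: "Lp_norm M p f \<le> ennreal A"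
  shows "integrable M f" and "(\<integral>x. \<bar>f x\<bar> \<partial>M) \<le> A"
proof -
  have [measurable]: "f \<in> borel_measurable M"
    using f by (auto simp: Lp_norm_def top_unique split: if_splits)
  have "integrable M f \<and> (\<integral>x. \<bar>f x\<bar> \<partial>M) \<le> A"
  proof (cases "p = \<infinity>")
    case True
    have b: "AE x in M. \<bar>f x\<bar> \<le> A"
      using f A True by (simp add: Lp_norm_le_iff_infinity)
    then have i: "integrable M f"
      by (intro integrable_const_bound) auto
    have "(\<integral>x. \<bar>f x\<bar> \<partial>M) \<le> (\<integral>x. A \<partial>M)"
      using b i by (intro integral_mono_AE) auto
    with i show ?thesis
      by (simp add: prob_space)
  next
    case False
    define r where "r = enn2real p"
    have r: "1 \<le> r"
      using p False unfolding r_def by (cases p) auto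
    have F: "integrable M (\<lambda>x. \<bar>f x\<bar> powr r)" "(\<integral>x. \<bar>f x\<bar> powr r \<partial>M) \<le> A powr r"
      using f A by (simp_all add: Lp_norm_le_iff_finite[OF p False] r_def)
    have i: "integrable M f"
    proof (rule Bochner_Integration.integrable_bound)
      show "integrable M (\<lambda>x. 1 + \<bar>f x\<bar> powr r)"
        using F by simp
      have "norm (f x) \<le> norm (1 + \<bar>f x\<bar> powr r)" for x
      proof (cases "\<bar>f x\<bar> \<le> 1")
        case False
        then have "\<bar>f x\<bar> powr 1 \<le> \<bar>f x\<bar> powr r"
          using r by (intro powr_mono) auto
        with False show ?thesis
          by simp
      qed (simp add: add_increasing2)
      then show "AE x in M. norm (f x) \<le> norm (1 + \<bar>f x\<bar> powr r)"
        by simp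
    qed simp
    define g where "g = (\<lambda>x. \<bar>f x\<bar> + 1)"
    have "Lp_norm M p g \<le> ennreal (A + 1)"
      using p A f Lp_norm_const_le[OF p, of 1]
      by (intro Lp_norm_triangle[where f = f and g = "\<lambda>_. 1"]) (auto simp: g_def)
    then have G: "integrable M (\<lambda>x. g x powr r)" "(\<integral>x. g x powr r \<partial>M) \<le> (A + 1) powr r"
      using A by (simp_all add: Lp_norm_le_iff_finite[OF p False] r_def g_def del: ennreal_plus)
    have "expectation g powr r \<le> (\<integral>x. g x powr r \<partial>M)"
      by (rule jensens_inequality[where I = "{0<..}"])
         (use i G powr_convex[OF r] in \<open>auto simp: g_def\<close>)
    also note G(2)
    also have "expectation g = (\<integral>x. \<bar>f x\<bar> \<partial>M) + 1"
      using i by (simp add: g_def prob_space)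
    finally have "(\<integral>x. \<bar>f x\<bar> \<partial>M) + 1 \<le> A + 1"
      using r A by (smt (verit) powr_less_mono2)
    with i show ?thesis
      by simp
  qed
  then show "integrable M f" and "(\<integral>x. \<bar>f x\<bar> \<partial>M) \<le> A"
    by simp_all
qed

section \<open>Concentration and product events\<close>

lemma indep_vars_PiM_components:
  assumes M: "\<And>i. i \<in> I \<Longrightarrow> prob_space (M i)" and I: "I \<noteq> {}"
  shows "prob_space.indep_vars (PiM I M) M (\<lambda>i x. x i) I"
proof -
  interpret prob_space "PiM I M"
    using M by (rule prob_space_PiM)
  have "distr (PiM I M) (PiM I M) (\<lambda>x. \<lambda>i\<in>I. x i) = distr (PiM I M) (PiM I M) (\<lambda>x. x)"
    by (intro distr_cong) (auto simp: space_PiM PiE_restrict)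
  also have "\<dots> = PiM I (\<lambda>i. distr (PiM I M) (M i) (\<lambda>x. x i))"
    using M by (simp add: distr_PiM_component cong: PiM_cong)
  finally show ?thesis
    using I by (simp add: indep_vars_iff_distr_eq_PiM')
qed

text \<open>
  The number of sample points that fall in \<open>B\<close> is a sum of independent indicators, so both
  one-sided deviations of the empirical frequency obey Hoeffding's inequality.
\<close>

lemma empirical_frequency_Hoeffding:
  fixes M :: "'b measure" and m :: nat and \<eta> :: real
  assumes M: "prob_space M" and B [measurable]: "B \<in> sets M" and m: "1 \<le> m" and \<eta>: "0 \<le> \<eta>"
  defines "P \<equiv> (\<Pi>\<^sub>M i\<in>{1..m}. M)"
  shows "measure P {D \<in> space P. (\<Sum>i=1..m. of_bool (D i \<in> B)) / real m \<ge> measure M B + \<eta>}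
      \<le> exp (- 2 * real m * \<eta>\<^sup>2)" (is ?ge)
    and "measure P {D \<in> space P. (\<Sum>i=1..m. of_bool (D i \<in> B)) / real m \<le> measure M B - \<eta>}
      \<le> exp (- 2 * real m * \<eta>\<^sup>2)" (is ?le)
proof -
  interpret M: prob_space M by fact
  interpret P: prob_space P
    unfolding P_def using M by (intro prob_space_PiM)
  define X where "X = (\<lambda>(i :: nat) (D :: nat \<Rightarrow> 'b). of_bool (D i \<in> B) :: real)"
  have B': "B \<inter> space M = B"
    using sets.sets_into_space[OF B] by auto
  have X: "(\<lambda>z. of_bool (z \<in> B) :: real) \<in> borel_measurable M"
    by measurable
  have EX: "P.expectation (X i) = measure M B" if "i \<in> {1..m}" for i
  proof -
    have "P.expectation (X i) = (\<integral>z. of_bool (z \<in> B) \<partial>distr P M (\<lambda>D. D i))"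
      unfolding P_def X_def using that by (subst integral_distr) auto
    also have "distr P M (\<lambda>D. D i) = M"
      unfolding P_def using that M by (intro distr_PiM_component)
    also have "(\<integral>z. of_bool (z \<in> B) \<partial>M) = (\<integral>z. indicator B z \<partial>M)"
      by (intro Bochner_Integration.integral_cong) (auto simp: indicator_def)
    finally show ?thesis
      using B' by simp
  qed
  have "P.indep_vars (\<lambda>_. M) (\<lambda>i D. D i) {1..m}"
    unfolding P_def using M m by (intro indep_vars_PiM_components) auto
  then have indep: "P.indep_vars (\<lambda>_. borel) X {1..m}"
    unfolding X_def using X by (rule P.indep_vars_compose2)
  interpret Hoeffding_ineq P "{1..m}" X "\<lambda>_. 0" "\<lambda>_. 1" "real m * measure M B"
  proof unfold_locales
    have "(\<Sum>i\<in>{1..m}. P.expectation (X i)) = real m * measure M B"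
      using EX by simp
    then show "real m * measure M B \<equiv> \<Sum>i\<in>{1..m}. P.expectation (X i)"
      by (simp only: atomize_eq)
  qed (use indep in \<open>auto simp: X_def\<close>)
  have \<eta>m: "0 \<le> real m * \<eta>"
    using \<eta> by simp
  have exponent: "- 2 * (real m * \<eta>)\<^sup>2 / (\<Sum>i\<in>{1..m}. (1 - 0)\<^sup>2) = - 2 * real m * \<eta>\<^sup>2"
    using m by (simp add: power2_eq_square)
  have ge: "S / real m \<ge> measure M B + \<eta> \<longleftrightarrow> real m * measure M B + real m * \<eta> \<le> S"
    and le: "S / real m \<le> measure M B - \<eta> \<longleftrightarrow> S \<le> real m * measure M B - real m * \<eta>" for S
    using m by (simp_all add: field_simps)
  show ?ge
    using Hoeffding_ineq_ge[OF \<eta>m] m unfolding exponent ge X_def by simp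
  show ?le
    using Hoeffding_ineq_le[OF \<eta>m] m unfolding exponent le X_def by simp
qed

text \<open>
  Probability of a two-stage event: the first stage fails with probability at most \<open>a\<close>, and given
  any successful outcome \<open>d\<close> the second one fails with probability at most \<open>b\<close>. The product
  $(1 - a)(1 - b)$ is at least $1 - (a + b)$.
\<close>

lemma measure_pair_ge:
  assumes "prob_space M" "prob_space N"
    and B: "B \<in> sets (M \<Otimes>\<^sub>M N)" and G [measurable]: "G \<in> sets M"
    and a: "1 - a \<le> measure M G"
    and b: "\<And>d. d \<in> G \<Longrightarrow> 1 - b \<le> measure N (Pair d -` B)" and "0 \<le> b" "b \<le> 1"
  shows "1 - (a + b) \<le> measure (M \<Otimes>\<^sub>M N) B"
proof -
  interpret M: prob_space M by fact
  interpret N: prob_space N by fact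
  interpret pair_prob_space M N ..
  have "ennreal ((1 - b) * measure M G) = (\<integral>\<^sup>+d. ennreal (1 - b) * indicator G d \<partial>M)"
    using \<open>b \<le> 1\<close> by (simp add: nn_integral_cmult_indicator M.emeasure_eq_measure ennreal_mult)
  also have "\<dots> \<le> (\<integral>\<^sup>+d. emeasure N (Pair d -` B) \<partial>M)"
    using b by (intro nn_integral_mono) (auto simp: N.emeasure_eq_measure indicator_def intro!: ennreal_leI)
  also have "\<dots> = ennreal (measure (M \<Otimes>\<^sub>M N) B)"
    using N.emeasure_pair_measure_alt[OF B] by (simp add: emeasure_eq_measure)
  finally have "(1 - b) * measure M G \<le> measure (M \<Otimes>\<^sub>M N) B"
    by simp
  moreover have "b * measure M G \<le> b * 1"
    using \<open>0 \<le> b\<close> by (intro mult_left_mono) auto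
  ultimately show ?thesis
    using a by (simp add: algebra_simps)
qed

section \<open>Coverage of perturbed quantile intervals\<close>

lemma (in real_distribution) cdf_superlevel_set:
  assumes "0 < \<tau>" "\<tau> < 1"
  shows "{t. cdf M t \<ge> \<tau>} \<noteq> {}" and "bdd_below {t. cdf M t \<ge> \<tau>}"
proof -
  have "eventually (\<lambda>t. cdf M t > \<tau>) at_top"
    using cdf_lim_at_top_prob assms by (intro order_tendstoD) auto
  then obtain a where "cdf M a > \<tau>"
    by (auto simp: eventually_at_top_linorder)
  then show "{t. cdf M t \<ge> \<tau>} \<noteq> {}"
    by (auto intro!: exI[of _ a])
  have "eventually (\<lambda>t. cdf M t < \<tau>) at_bot"
    using cdf_lim_at_bot assms by (intro order_tendstoD) auto
  then obtain b where b: "cdf M b < \<tau>"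
    by (auto simp: eventually_at_bot_linorder)
  have "b \<le> t" if "t \<in> {t. cdf M t \<ge> \<tau>}" for t
    using that b cdf_nondecreasing[of t b] by force
  then show "bdd_below {t. cdf M t \<ge> \<tau>}"
    by (rule bdd_belowI)
qed

text \<open>
  The upper mass bound of a single conditional law. It excludes atoms and makes the distribution
  function Lipschitz, so masses of closed intervals are differences of distribution function
  values.
\<close>

locale lipschitz_distribution = real_distribution +
  fixes \<mu> :: real
  assumes mass_le: "u \<le> v \<Longrightarrow> measure M {u..v} \<le> \<mu> * (v - u)"
begin

lemma measure_Icc: "measure M {u..v} = max 0 (cdf M v - cdf M u)"
proof (cases "u \<le> v")
  case True
  have "measure M {u} = 0"
    using mass_le[of u u] measure_nonneg[of M "{u}"] by simp
  moreover have "measure M {u<..v} = cdf M v - cdf M u"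
  proof (cases "u = v")
    case False
    with True show ?thesis
      using cdf_diff_eq[of u v] by simp
  qed simp
  moreover have "measure M ({u} \<union> {u<..v}) = measure M {u} + measure M {u<..v}"
    by (intro finite_measure_Union) auto
  moreover have "{u..v} = {u} \<union> {u<..v}"
    using True by auto
  ultimately have "measure M {u..v} = cdf M v - cdf M u"
    by simp
  then show ?thesis
    using measure_nonneg[of M "{u..v}"] by simp
next
  case False
  then show ?thesis
    using cdf_nondecreasing[of v u] by simp
qed

lemma cdf_diff_le: "\<bar>cdf M v - cdf M u\<bar> \<le> \<mu> * \<bar>v - u\<bar>"
proof -
  have "cdf M v - cdf M u \<le> \<mu> * (v - u)" "cdf M u \<le> cdf M v" if "u \<le> v" for u v
    using that mass_le[OF that] cdf_nondecreasing[OF that] unfolding measure_Icc by simp_all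
  from this[of u v] this[of v u] show ?thesis
    by (cases "u \<le> v") auto
qed

lemma lipschitz_const_nonneg: "0 \<le> \<mu>"
  using cdf_diff_le[of 1 0] by simp

text \<open>
  Points of the superlevel set lie arbitrarily close to its infimum from the right, and no point
  to the left of it belongs to the set; continuity forces the value \<open>\<tau>\<close>.
\<close>

lemma cdf_quantile:
  assumes "0 < \<tau>" "\<tau> < 1"
  shows "cdf M (Inf {t. cdf M t \<ge> \<tau>}) = \<tau>"
proof -
  define S where "S = {t. cdf M t \<ge> \<tau>}"
  define q where "q = Inf S"
  have ne: "S \<noteq> {}" and bdd: "bdd_below S"
    unfolding S_def using assms by (rule cdf_superlevel_set)+
  have close: "\<bar>cdf M (q + e) - cdf M q\<bar> \<le> \<mu> * \<bar>e\<bar>" for e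
    using cdf_diff_le[of "q + e" q] by simp
  have "\<tau> \<le> cdf M q + \<mu> * e" if e: "0 < e" for e
  proof -
    obtain t where t: "t \<in> S" "t < q + e"
      using cInf_lessD[OF ne, of "q + e"] e unfolding q_def by auto
    then have "\<tau> \<le> cdf M (q + e)"
      using cdf_nondecreasing[of t "q + e"] by (simp add: S_def)
    then show ?thesis
      using close[of e] e by simp
  qed
  moreover have "cdf M q - \<mu> * e \<le> \<tau>" if "0 < e" for e
  proof -
    have "q - e \<notin> S"
      using cInf_lower[OF _ bdd, of "q - e"] that by (auto simp: q_def)
    then show ?thesis
      using close[of "-e"] that by (simp add: S_def)
  qed
  ultimately have near: "\<bar>cdf M q - \<tau>\<bar> \<le> \<mu> * e" if "0 < e" for e
    using that by (smt (verit, best))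
  have "\<bar>cdf M q - \<tau>\<bar> \<le> 0 + e" if "0 < e" for e
  proof -
    have "\<mu> * (e / (\<mu> + 1)) \<le> e"
      using that lipschitz_const_nonneg by (simp add: field_simps)
    with near[of "e / (\<mu> + 1)"] show ?thesis
      using that lipschitz_const_nonneg by simp
  qed
  then have "\<bar>cdf M q - \<tau>\<bar> \<le> 0"
    by (rule field_le_epsilon)
  then show ?thesis
    by (simp add: q_def S_def)
qed

text \<open>
  The oracle interval has mass $1 - \<alpha>$. Widening it by \<open>t\<close> on both sides gains mass at least
  $2 c t$, and narrowing it loses at least as much; moving its endpoints changes the mass by at
  most \<open>\<mu>\<close> times the total displacement \<open>e\<close>. The mass of an interval is the positive part of a
  difference of distribution function values, and for the upper bound the positive part matters
  only when the narrowed interval is empty. For that case the hypothesis $2 \<mu> t \<le> 1 - \<alpha>$ keeps the claimed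
  upper bound nonnegative.
\<close>

lemma coverage_bounds:
  fixes \<alpha> t r0 c ql qu lo hi :: real
  assumes \<alpha>: "0 < \<alpha>" "\<alpha> < 1" and t: "0 \<le> t" "t \<le> r0" and c: "c \<le> \<mu>"
    and ql: "ql = Inf {s. cdf M s \<ge> \<alpha> / 2}" and qu: "qu = Inf {s. cdf M s \<ge> 1 - \<alpha> / 2}"
    and mass_ge: "\<And>q h. q \<in> {ql, qu} \<Longrightarrow> 0 \<le> h \<Longrightarrow> h \<le> r0 \<Longrightarrow>
      measure M {q - h..q} \<ge> c * h \<and> measure M {q..q + h} \<ge> c * h"
  defines "e \<equiv> \<bar>lo - ql\<bar> + \<bar>hi - qu\<bar>"
  shows "measure M {lo - t..hi + t} \<ge> 1 - \<alpha> + 2 * c * t - \<mu> * e"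
    and "2 * \<mu> * t \<le> 1 - \<alpha> \<Longrightarrow> measure M {lo + t..hi - t} \<le> 1 - \<alpha> - 2 * c * t + \<mu> * e"
proof -
  have F: "cdf M ql = \<alpha> / 2" "cdf M qu = 1 - \<alpha> / 2"
    unfolding ql qu by (rule cdf_quantile; use \<alpha> in simp)+
  have grow: "c * t \<le> cdf M (q + t) - cdf M q" "c * t \<le> cdf M q - cdf M (q - t)"
    if "q \<in> {ql, qu}" for q
    using mass_ge[OF that t] t cdf_nondecreasing[of q "q + t"] cdf_nondecreasing[of "q - t" q]
    by (simp_all add: measure_Icc)
  have e: "\<mu> * e = \<mu> * \<bar>lo - ql\<bar> + \<mu> * \<bar>hi - qu\<bar>"
    by (simp add: e_def distrib_left)
  have shift: "\<bar>cdf M (lo + s) - cdf M (ql + s)\<bar> + \<bar>cdf M (hi + s') - cdf M (qu + s')\<bar> \<le> \<mu> * e"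
    for s s'
    using cdf_diff_le[of "lo + s" "ql + s"] cdf_diff_le[of "hi + s'" "qu + s'"] by (simp add: e)
  show "measure M {lo - t..hi + t} \<ge> 1 - \<alpha> + 2 * c * t - \<mu> * e"
    using shift[of "-t" t] grow(1)[of qu] grow(2)[of ql] F by (simp add: measure_Icc)
  assume "2 * \<mu> * t \<le> 1 - \<alpha>"
  moreover have "c * t \<le> \<mu> * t"
    using c t by (simp add: mult_right_mono)
  moreover have "0 \<le> \<mu> * e"
    using lipschitz_const_nonneg by (simp add: e_def)
  ultimately show "measure M {lo + t..hi - t} \<le> 1 - \<alpha> - 2 * c * t + \<mu> * e"
    using shift[of t "-t"] grow(1)[of ql] grow(2)[of qu] F by (simp add: measure_Icc)
qed

end

section \<open>Joint law and score distribution\<close>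

lemma kernel_real_distribution:
  assumes "K \<in> PX \<rightarrow>\<^sub>M prob_algebra borel" "x \<in> space PX"
  shows "real_distribution (K x)"
proof -
  have "K x \<in> space (prob_algebra borel)"
    using assms by (rule measurable_space)
  then show ?thesis
    by (simp add: space_prob_algebra real_distribution_def real_distribution_axioms_def
        sets_eq_imp_space_eq)
qed

context
  fixes PX :: "'a measure" and K :: "'a \<Rightarrow> real measure"
  assumes PX: "prob_space PX" and K [measurable]: "K \<in> PX \<rightarrow>\<^sub>M prob_algebra borel"
begin

interpretation PX: prob_space PX by (fact PX)

lemma joint_kernel_measurable:
  "(\<lambda>x. K x \<bind> (\<lambda>y. return (PX \<Otimes>\<^sub>M borel) (x, y))) \<in> PX \<rightarrow>\<^sub>M prob_algebra (PX \<Otimes>\<^sub>M borel)"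
  by measurable

lemma PX_in_prob_algebra: "PX \<in> space (prob_algebra PX)"
  by (simp add: space_prob_algebra PX)

lemma prob_space_joint_law: "prob_space (joint_law PX K)"
  unfolding joint_law_def by (rule prob_space_bind'[OF PX_in_prob_algebra joint_kernel_measurable])

lemma sets_joint_law [measurable_cong]: "sets (joint_law PX K) = sets (PX \<Otimes>\<^sub>M borel)"
  unfolding joint_law_def by (rule sets_bind'[OF PX_in_prob_algebra joint_kernel_measurable])

text \<open>
  Disintegration of the joint law along the covariate: the kernel at \<open>x\<close> is the image of the
  conditional law at \<open>x\<close> under \<open>Pair x\<close>.
\<close>

lemma measure_joint_law:
  assumes A: "A \<in> sets (PX \<Otimes>\<^sub>M borel)"
  shows "(\<lambda>x. measure (K x) (Pair x -` A)) \<in> borel_measurable PX"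
    and "measure (joint_law PX K) A = (\<integral>x. measure (K x) (Pair x -` A) \<partial>PX)"
proof -
  let ?J = "\<lambda>x. K x \<bind> (\<lambda>y. return (PX \<Otimes>\<^sub>M borel) (x, y))"
  have J: "emeasure (?J x) A = ennreal (measure (K x) (Pair x -` A))" if x: "x \<in> space PX" for x
  proof -
    interpret real_distribution "K x"
      using K x by (rule kernel_real_distribution)
    have "?J x = distr (K x) (PX \<Otimes>\<^sub>M borel) (Pair x)"
      using x by (intro bind_return_distr') auto
    then have "emeasure (?J x) A = emeasure (K x) (Pair x -` A)"
      using x A by (simp add: emeasure_distr)
    then show ?thesis
      by (simp add: emeasure_eq_measure)
  qed
  have "(\<lambda>x. emeasure (?J x) A) \<in> borel_measurable PX"
    using measurable_prob_algebraD[OF joint_kernel_measurable] A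
    by (rule measurable_emeasure_kernel)
  then have "(\<lambda>x. ennreal (measure (K x) (Pair x -` A))) \<in> borel_measurable PX"
    by (simp add: J cong: measurable_cong)
  then have "(\<lambda>x. enn2real (ennreal (measure (K x) (Pair x -` A)))) \<in> borel_measurable PX"
    by (rule borel_measurable_enn2real)
  then show meas: "(\<lambda>x. measure (K x) (Pair x -` A)) \<in> borel_measurable PX"
    by simp
  have "emeasure (joint_law PX K) A = (\<integral>\<^sup>+x. emeasure (?J x) A \<partial>PX)"
    unfolding joint_law_def
    by (rule emeasure_bind_prob_algebra[OF PX_in_prob_algebra joint_kernel_measurable A])
  also have "\<dots> = (\<integral>\<^sup>+x. ennreal (measure (K x) (Pair x -` A)) \<partial>PX)"
    by (intro nn_integral_cong J)
  finally show "measure (joint_law PX K) A = (\<integral>x. measure (K x) (Pair x -` A) \<partial>PX)"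
    using meas by (simp add: measure_def[of "joint_law PX K"] integral_eq_nn_integral)
qed

end

lemma oracle_quantile_mono:
  assumes "real_distribution (K x)" "0 < \<sigma>" "\<sigma> \<le> \<tau>" "\<tau> < 1"
  shows "oracle_quantile K \<sigma> x \<le> oracle_quantile K \<tau> x"
proof -
  interpret real_distribution "K x" by fact
  have "0 < \<tau>" "\<sigma> < 1"
    using assms by simp_all
  show ?thesis
    unfolding oracle_quantile_def
  proof (rule cInf_superset_mono)
    show "{t. \<tau> \<le> cdf (K x) t} \<noteq> {}"
      using \<open>0 < \<tau>\<close> \<open>\<tau> < 1\<close> by (rule cdf_superlevel_set)
    show "bdd_below {t. \<sigma> \<le> cdf (K x) t}"
      using \<open>0 < \<sigma>\<close> \<open>\<sigma> < 1\<close> by (rule cdf_superlevel_set)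
    show "{t. \<tau> \<le> cdf (K x) t} \<subseteq> {t. \<sigma> \<le> cdf (K x) t}"
      using \<open>\<sigma> \<le> \<tau>\<close> by auto
  qed
qed

text \<open>
  The rearrangement inequality for two pairs of numbers: with the oracle endpoints in increasing
  order, the increasing order of the fitted ones makes the total distance smallest.
\<close>

lemma sorted_endpoints_error:
  assumes "ql \<le> qu"
  shows "\<bar>lower_endpoint \<alpha> g x - ql\<bar> + \<bar>upper_endpoint \<alpha> g x - qu\<bar>
    \<le> \<bar>g (\<alpha> / 2) x - ql\<bar> + \<bar>g (1 - \<alpha> / 2) x - qu\<bar>"
  using assms unfolding lower_endpoint_def upper_endpoint_def by linarith

lemma cqr_score_le_iff:
  "cqr_score \<alpha> g x y \<le> t \<longleftrightarrow> y \<in> {lower_endpoint \<alpha> g x - t..upper_endpoint \<alpha> g x + t}"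
  by (auto simp: cqr_score_def)

text \<open>
  Population coverage of the fitted interval widened, respectively narrowed, by \<open>t\<close>. The
  conditional coverage bounds are averaged over the covariate; the average total endpoint error is
  at most $2 \<epsilon>$ because an $L^1$ bound on each raw map is given.
\<close>

lemma score_cdf_bounds:
  fixes PX :: "'a measure" and K :: "'a \<Rightarrow> real measure" and g :: "real \<Rightarrow> 'a \<Rightarrow> real"
  assumes PX: "prob_space PX" and K: "K \<in> PX \<rightarrow>\<^sub>M prob_algebra borel"
    and \<alpha>: "0 < \<alpha>" "\<alpha> < 1" and reg: "mass_regularity PX K \<alpha> \<mu>low \<mu>up r0"
    and g [measurable]: "g (\<alpha> / 2) \<in> borel_measurable PX" "g (1 - \<alpha> / 2) \<in> borel_measurable PX"
    and err: "integrable PX (\<lambda>x. g (\<alpha> / 2) x - oracle_quantile K (\<alpha> / 2) x)"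
      "(\<integral>x. \<bar>g (\<alpha> / 2) x - oracle_quantile K (\<alpha> / 2) x\<bar> \<partial>PX) \<le> \<epsilon>"
      "integrable PX (\<lambda>x. g (1 - \<alpha> / 2) x - oracle_quantile K (1 - \<alpha> / 2) x)"
      "(\<integral>x. \<bar>g (1 - \<alpha> / 2) x - oracle_quantile K (1 - \<alpha> / 2) x\<bar> \<partial>PX) \<le> \<epsilon>"
    and t: "0 \<le> t" "t \<le> r0"
  defines "B \<equiv> \<lambda>t. {z \<in> space (joint_law PX K). cqr_score \<alpha> g (fst z) (snd z) \<le> t}"
  shows "B s \<in> sets (joint_law PX K)"
    and "1 - \<alpha> + 2 * \<mu>low * t - 2 * \<mu>up * \<epsilon> \<le> measure (joint_law PX K) (B t)"
    and "2 * \<mu>up * t \<le> 1 - \<alpha> \<Longrightarrow>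
      measure (joint_law PX K) (B (- t)) \<le> 1 - \<alpha> - 2 * \<mu>low * t + 2 * \<mu>up * \<epsilon>"
proof -
  interpret PX: prob_space PX by fact
  note sets_joint = sets_joint_law[OF PX K]
  have B_eq: "B s = {z \<in> space (PX \<Otimes>\<^sub>M borel). cqr_score \<alpha> g (fst z) (snd z) \<le> s}" for s
    using sets_eq_imp_space_eq[OF sets_joint] by (simp add: B_def)
  have B [measurable]: "B s \<in> sets (PX \<Otimes>\<^sub>M borel)" for s
    unfolding B_eq cqr_score_def lower_endpoint_def upper_endpoint_def by measurable
  then show "B s \<in> sets (joint_law PX K)"
    by (simp add: sets_joint)
  define c where "c = (\<lambda>s x. measure (K x) (Pair x -` B s))"
  have c: "c s x = measure (K x) {lower_endpoint \<alpha> g x - s..upper_endpoint \<alpha> g x + s}"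
    if "x \<in> space PX" for s x
    unfolding c_def using that
    by (intro arg_cong[where f = "measure (K x)"])
       (auto simp: B_eq cqr_score_le_iff space_pair_measure)
  have c_meas: "c s \<in> borel_measurable PX" for s
    unfolding c_def by (rule measure_joint_law(1)[OF PX K B])
  have "0 \<le> c s x \<and> c s x \<le> 1" if "x \<in> space PX" for s x
  proof -
    interpret real_distribution "K x"
      using K that by (rule kernel_real_distribution)
    show ?thesis
      by (simp add: c_def)
  qed
  then have c_int: "integrable PX (c s)" for s
    using c_meas by (intro PX.integrable_const_bound[where B = 1]) auto
  have mB: "measure (joint_law PX K) (B s) = (\<integral>x. c s x \<partial>PX)" for s
    unfolding c_def by (rule measure_joint_law(2)[OF PX K B])
  obtain X0 where X0: "X0 \<in> sets PX" "measure PX X0 = 1"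
    and up: "\<And>x u v. x \<in> X0 \<Longrightarrow> u \<le> v \<Longrightarrow> measure (K x) {u..v} \<le> \<mu>up * (v - u)"
    and low: "\<And>x \<tau> h. x \<in> X0 \<Longrightarrow> \<tau> \<in> {\<alpha> / 2, 1 - \<alpha> / 2} \<Longrightarrow> 0 \<le> h \<Longrightarrow> h \<le> r0 \<Longrightarrow>
      measure (K x) {oracle_quantile K \<tau> x - h .. oracle_quantile K \<tau> x} \<ge> \<mu>low * h \<and>
      measure (K x) {oracle_quantile K \<tau> x .. oracle_quantile K \<tau> x + h} \<ge> \<mu>low * h"
    and \<mu>: "0 < \<mu>low" "\<mu>low \<le> \<mu>up"
    using reg unfolding mass_regularity_def by metis
  have AE_X0: "AE x in PX. x \<in> X0"
    using X0 PX.prob_eq_1 by simp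
  define E where "E = (\<lambda>x. \<bar>g (\<alpha> / 2) x - oracle_quantile K (\<alpha> / 2) x\<bar>
    + \<bar>g (1 - \<alpha> / 2) x - oracle_quantile K (1 - \<alpha> / 2) x\<bar>)"
  have E_int: "integrable PX E" and E_le: "(\<integral>x. E x \<partial>PX) \<le> 2 * \<epsilon>"
    unfolding E_def using err by simp_all
  have "\<mu>up * (\<integral>x. E x \<partial>PX) \<le> \<mu>up * (2 * \<epsilon>)"
    using E_le \<mu> by (intro mult_left_mono) auto
  then have E_le': "\<mu>up * (\<integral>x. E x \<partial>PX) \<le> 2 * \<mu>up * \<epsilon>"
    by simp
  have pointwise: "1 - \<alpha> + 2 * \<mu>low * t - \<mu>up * E x \<le> c t x \<and>
      (2 * \<mu>up * t \<le> 1 - \<alpha> \<longrightarrow> c (- t) x \<le> 1 - \<alpha> - 2 * \<mu>low * t + \<mu>up * E x)"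
    if x: "x \<in> X0" for x
  proof -
    have xs: "x \<in> space PX"
      using x sets.sets_into_space[OF X0(1)] by auto
    interpret real_distribution "K x"
      using K xs by (rule kernel_real_distribution)
    interpret lipschitz_distribution "K x" \<mu>up
      using up[OF x] by unfold_locales
    let ?ql = "oracle_quantile K (\<alpha> / 2) x" and ?qu = "oracle_quantile K (1 - \<alpha> / 2) x"
    have "\<bar>lower_endpoint \<alpha> g x - ?ql\<bar> + \<bar>upper_endpoint \<alpha> g x - ?qu\<bar> \<le> E x"
      unfolding E_def using \<alpha>
      by (intro sorted_endpoints_error oracle_quantile_mono real_distribution_axioms) auto
    then have e: "\<mu>up * (\<bar>lower_endpoint \<alpha> g x - ?ql\<bar> + \<bar>upper_endpoint \<alpha> g x - ?qu\<bar>) \<le> \<mu>up * E x"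
      using \<mu> by (intro mult_left_mono) auto
    have "\<And>q h. q \<in> {?ql, ?qu} \<Longrightarrow> 0 \<le> h \<Longrightarrow> h \<le> r0 \<Longrightarrow>
      measure (K x) {q - h..q} \<ge> \<mu>low * h \<and> measure (K x) {q..q + h} \<ge> \<mu>low * h"
      using low[OF x] by auto
    note bounds = coverage_bounds[OF \<alpha> t \<mu>(2)
        oracle_quantile_def[of K "\<alpha> / 2" x] oracle_quantile_def[of K "1 - \<alpha> / 2" x] this,
      of "lower_endpoint \<alpha> g x" "upper_endpoint \<alpha> g x"]
    show ?thesis
      using bounds e c[OF xs, of t] c[OF xs, of "- t"] by auto
  qed
  have "1 - \<alpha> + 2 * \<mu>low * t - 2 * \<mu>up * \<epsilon> \<le> (\<integral>x. 1 - \<alpha> + 2 * \<mu>low * t - \<mu>up * E x \<partial>PX)"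
    using E_int E_le' by (simp add: PX.prob_space)
  also have "\<dots> \<le> (\<integral>x. c t x \<partial>PX)"
    using E_int c_int AE_X0 pointwise
    by (intro integral_mono_AE Bochner_Integration.integrable_diff) (auto elim: eventually_mono)
  finally show "1 - \<alpha> + 2 * \<mu>low * t - 2 * \<mu>up * \<epsilon> \<le> measure (joint_law PX K) (B t)"
    by (simp add: mB)
  assume "2 * \<mu>up * t \<le> 1 - \<alpha>"
  then have "(\<integral>x. c (- t) x \<partial>PX) \<le> (\<integral>x. 1 - \<alpha> - 2 * \<mu>low * t + \<mu>up * E x \<partial>PX)"
    using E_int c_int AE_X0 pointwise
    by (intro integral_mono_AE Bochner_Integration.integrable_add) (auto elim: eventually_mono)
  also have "\<dots> \<le> 1 - \<alpha> - 2 * \<mu>low * t + 2 * \<mu>up * \<epsilon>"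
    using E_int E_le' by (simp add: PX.prob_space)
  finally show "measure (joint_law PX K) (B (- t)) \<le> 1 - \<alpha> - 2 * \<mu>low * t + 2 * \<mu>up * \<epsilon>"
    by (simp add: mB)
qed

section \<open>Threshold and length of the prediction set\<close>

text \<open>
  By monotonicity the superlevel set is closed upwards, so comparing the function with the level at
  two points brackets its infimum. This is what lets two pointwise deviation bounds control the
  empirical quantile.
\<close>

lemma gen_inverse_between:
  assumes H: "mono H" and "H a < \<tau>" "\<tau> \<le> H b"
  shows "\<exists>Q. gen_inverse \<tau> H = ereal Q \<and> a \<le> Q \<and> Q \<le> b"
proof -
  have "ereal a \<le> gen_inverse \<tau> H"
    unfolding gen_inverse_def
  proof (intro INF_greatest)
    fix t assume "t \<in> {t. \<tau> \<le> H t}"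
    then have "\<not> t \<le> a"
      using monoD[OF H, of t a] \<open>H a < \<tau>\<close> by auto
    then show "ereal a \<le> ereal t"
      by simp
  qed
  moreover have "gen_inverse \<tau> H \<le> ereal b"
    unfolding gen_inverse_def using \<open>\<tau> \<le> H b\<close> by (intro INF_lower) simp
  ultimately show ?thesis
    by (cases "gen_inverse \<tau> H") auto
qed

lemma mono_empirical_score_cdf: "mono (empirical_score_cdf \<alpha> g m D)"
  unfolding empirical_score_cdf_def
  by (intro monoI divide_right_mono sum_mono) auto

lemma measure_lborel_Icc_max: "measure lborel {a..b} = max 0 (b - a)" for a b :: real
  by (cases "a \<le> b") auto

lemma length_cqr_set:
  assumes "cqr_threshold \<alpha> g m D = ereal Q"
  shows "measure lborel (cqr_set \<alpha> g m D x) =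
    max 0 (upper_endpoint \<alpha> g x - lower_endpoint \<alpha> g x + 2 * Q)"
proof -
  have "cqr_set \<alpha> g m D x = {lower_endpoint \<alpha> g x - Q..upper_endpoint \<alpha> g x + Q}"
    by (auto simp: cqr_set_def assms cqr_score_le_iff)
  then show ?thesis
    by (simp add: measure_lborel_Icc_max algebra_simps)
qed

text \<open>
  The set has length $(u - l + 2 Q)_+$, where $l \<le> u$ are the sorted fitted endpoints, and the
  oracle interval has length $(q_u - q_l)_+$. The positive part is $1$-Lipschitz, so the lengths differ
  by at most the total endpoint error plus $2 |Q|$, whose norms add up.
\<close>

lemma (in prob_space) length_error_Lp:
  assumes p: "1 \<le> p" and \<epsilon>: "0 \<le> \<epsilon>"
    and [measurable]: "g (\<alpha> / 2) \<in> borel_measurable M" "g (1 - \<alpha> / 2) \<in> borel_measurable M"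
      "ql \<in> borel_measurable M" "qu \<in> borel_measurable M"
    and err: "Lp_norm M p (\<lambda>x. g (\<alpha> / 2) x - ql x) \<le> ennreal \<epsilon>"
      "Lp_norm M p (\<lambda>x. g (1 - \<alpha> / 2) x - qu x) \<le> ennreal \<epsilon>"
    and sorted: "\<And>x. x \<in> space M \<Longrightarrow> ql x \<le> qu x" and Q: "\<bar>Q\<bar> \<le> b"
  shows "Lp_norm M p (\<lambda>x. max 0 (upper_endpoint \<alpha> g x - lower_endpoint \<alpha> g x + 2 * Q)
      - max 0 (qu x - ql x)) \<le> ennreal (2 * \<epsilon> + 2 * b)"
proof -
  have [measurable]: "lower_endpoint \<alpha> g \<in> borel_measurable M" "upper_endpoint \<alpha> g \<in> borel_measurable M"
    unfolding lower_endpoint_def[abs_def] upper_endpoint_def[abs_def] by measurable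
  define E where "E = (\<lambda>x. \<bar>g (\<alpha> / 2) x - ql x\<bar> + \<bar>g (1 - \<alpha> / 2) x - qu x\<bar>)"
  have "Lp_norm M p E \<le> ennreal (\<epsilon> + \<epsilon>)"
    by (rule Lp_norm_triangle[OF p \<epsilon> \<epsilon> err]) (auto simp: E_def)
  moreover have "Lp_norm M p (\<lambda>_. 2 * b) \<le> ennreal (2 * b)"
    using Q by (intro Lp_norm_const_le p) auto
  ultimately have "Lp_norm M p (\<lambda>x. max 0 (upper_endpoint \<alpha> g x - lower_endpoint \<alpha> g x + 2 * Q)
      - max 0 (qu x - ql x)) \<le> ennreal ((\<epsilon> + \<epsilon>) + 2 * b)"
  proof (rule Lp_norm_triangle[OF p, rotated 2])
    have "\<bar>max 0 (upper_endpoint \<alpha> g x - lower_endpoint \<alpha> g x + 2 * Q) - max 0 (qu x - ql x)\<bar>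
        \<le> \<bar>E x\<bar> + \<bar>2 * b\<bar>" if "x \<in> space M" for x
    proof -
      have "\<bar>max 0 u - max 0 v\<bar> \<le> \<bar>u - v\<bar>" for u v :: real
        by linarith
      also have "\<bar>(upper_endpoint \<alpha> g x - lower_endpoint \<alpha> g x + 2 * Q) - (qu x - ql x)\<bar>
          \<le> \<bar>lower_endpoint \<alpha> g x - ql x\<bar> + \<bar>upper_endpoint \<alpha> g x - qu x\<bar> + 2 * b"
        using Q by linarith
      also have "\<dots> \<le> E x + 2 * b"
        using sorted_endpoints_error[OF sorted[OF that], of \<alpha> g] by (simp add: E_def)
      finally show ?thesis
        by linarith
    qed
    then show "AE x in M. \<bar>max 0 (upper_endpoint \<alpha> g x - lower_endpoint \<alpha> g x + 2 * Q)
        - max 0 (qu x - ql x)\<bar> \<le> \<bar>E x\<bar> + \<bar>2 * b\<bar>"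
      by (rule AE_I2)
  qed (use Q \<epsilon> in auto)
  then show ?thesis
    by simp
qed

section \<open>Calibration and the length bound\<close>

text \<open>
  A margin of \<open>deviation_scale m \<delta>\<close> between the level and the population values at two fixed points is
  lost at each of them with probability at most $\<delta> / 4$: the scale is chosen so that Hoeffding's
  exponential bound takes exactly this value.
\<close>

lemma calibration_event:
  fixes PX :: "'a measure" and K :: "'a \<Rightarrow> real measure" and g :: "real \<Rightarrow> 'a \<Rightarrow> real" and \<alpha> \<beta> \<delta> a b :: real
  assumes J: "prob_space (joint_law PX K)" and m: "1 \<le> m" and \<delta>: "0 < \<delta>" "\<delta> < 1"
  defines "B \<equiv> \<lambda>t. {z \<in> space (joint_law PX K). cqr_score \<alpha> g (fst z) (snd z) \<le> t}"
  assumes B: "\<And>t. B t \<in> sets (joint_law PX K)"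
    and above: "\<beta> + deviation_scale m \<delta> \<le> measure (joint_law PX K) (B b)"
    and below: "measure (joint_law PX K) (B a) + deviation_scale m \<delta> \<le> \<beta>"
  shows "1 - \<delta> / 2 \<le> measure (sample_law PX K m) {D \<in> space (sample_law PX K m).
    empirical_score_cdf \<alpha> g m D a < \<beta> \<and> \<beta> \<le> empirical_score_cdf \<alpha> g m D b}"
proof -
  let ?P = "sample_law PX K m" and ?F = "empirical_score_cdf \<alpha> g m"
  define \<eta> where "\<eta> = deviation_scale m \<delta>"
  interpret P: prob_space ?P
    unfolding sample_law_def using J by (intro prob_space_PiM)
  have ln_pos: "0 \<le> ln (4 / \<delta>)"
    using \<delta> by (intro ln_ge_zero) simp
  have \<eta>: "0 \<le> \<eta>"
    unfolding \<eta>_def deviation_scale_def using ln_pos by simp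
  have "- 2 * real m * \<eta>\<^sup>2 = - ln (4 / \<delta>)"
    unfolding \<eta>_def deviation_scale_def using ln_pos m by simp
  then have tail: "exp (- 2 * real m * \<eta>\<^sup>2) = \<delta> / 4"
    using \<delta> by (simp add: exp_minus)
  have F: "?F D t = (\<Sum>i=1..m. of_bool (D i \<in> B t)) / real m" if "D \<in> space ?P" for D t
  proof -
    have "D i \<in> space (joint_law PX K)" if "i \<in> {1..m}" for i
      using \<open>D \<in> space ?P\<close> that by (auto simp: sample_law_def space_PiM)
    then show ?thesis
      unfolding empirical_score_cdf_def B_def by (intro arg_cong2[where f = "(/)"] sum.cong) auto
  qed
  have G [measurable]: "(\<lambda>D. (\<Sum>i=1..m. of_bool (D i \<in> B t)) / real m :: real) \<in> borel_measurable ?P"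
    for t
  proof -
    have "(\<lambda>z. of_bool (z \<in> B t) :: real) \<in> borel_measurable (joint_law PX K)"
      using B[of t] by measurable
    then show ?thesis
      unfolding sample_law_def
      by (intro borel_measurable_divide borel_measurable_sum borel_measurable_const
          measurable_PiM_component_rev)
  qed
  define U where "U = {D \<in> space ?P. \<beta> \<le> (\<Sum>i=1..m. of_bool (D i \<in> B a)) / real m}"
  define L where "L = {D \<in> space ?P. (\<Sum>i=1..m. of_bool (D i \<in> B b)) / real m < \<beta>}"
  have [measurable]: "U \<in> sets ?P" "L \<in> sets ?P"
    unfolding U_def L_def by measurable
  note Hoeffding = empirical_frequency_Hoeffding[OF J B m \<eta>, folded sample_law_def, unfolded tail]
  have "measure ?P U \<le> measure ?P {D \<in> space ?P.
      measure (joint_law PX K) (B a) + \<eta> \<le> (\<Sum>i=1..m. of_bool (D i \<in> B a)) / real m}"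
  proof (rule P.finite_measure_mono)
    show "U \<subseteq> {D \<in> space ?P.
        measure (joint_law PX K) (B a) + \<eta> \<le> (\<Sum>i=1..m. of_bool (D i \<in> B a)) / real m}"
      unfolding U_def \<eta>_def using below by (intro Collect_mono) auto
  qed measurable
  also note Hoeffding(1)[of a]
  finally have "measure ?P U \<le> \<delta> / 4" .
  moreover have "measure ?P L \<le> measure ?P {D \<in> space ?P.
      (\<Sum>i=1..m. of_bool (D i \<in> B b)) / real m \<le> measure (joint_law PX K) (B b) - \<eta>}"
  proof (rule P.finite_measure_mono)
    show "L \<subseteq> {D \<in> space ?P.
        (\<Sum>i=1..m. of_bool (D i \<in> B b)) / real m \<le> measure (joint_law PX K) (B b) - \<eta>}"
      unfolding L_def \<eta>_def using above by (intro Collect_mono) auto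
  qed measurable
  then have "measure ?P L \<le> \<delta> / 4"
    using Hoeffding(2)[of b] by linarith
  ultimately have "measure ?P (U \<union> L) \<le> \<delta> / 2"
    using measure_Un_le[of U ?P L] by simp
  then have "1 - \<delta> / 2 \<le> measure ?P (space ?P - (U \<union> L))"
    by (subst P.prob_compl) auto
  also have "space ?P - (U \<union> L) = {D \<in> space ?P. ?F D a < \<beta> \<and> \<beta> \<le> ?F D b}"
    by (auto simp: U_def L_def F)
  finally show ?thesis .
qed

text \<open>
  The training and the calibration sample enter jointly, which is what makes the final event
  measurable on the product of the two sample spaces.
\<close>

lemma empirical_score_cdf_measurable:
  assumes K: "prob_space PX" "K \<in> PX \<rightarrow>\<^sub>M prob_algebra borel"
    and f: "\<And>\<tau>. \<tau> \<in> {\<alpha> / 2, 1 - \<alpha> / 2} \<Longrightarrow> (\<lambda>(d, x). f d \<tau> x) \<in> borel_measurable (S \<Otimes>\<^sub>M PX)"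
  shows "(\<lambda>w. empirical_score_cdf \<alpha> (f (fst w)) m (snd w) t) \<in> borel_measurable (S \<Otimes>\<^sub>M sample_law PX K m)"
proof -
  let ?P = "sample_law PX K m"
  have comp: "(\<lambda>w. snd w i) \<in> S \<Otimes>\<^sub>M ?P \<rightarrow>\<^sub>M PX \<Otimes>\<^sub>M borel" if "i \<in> {1..m}" for i
  proof -
    have "(\<lambda>D. D i) \<in> ?P \<rightarrow>\<^sub>M joint_law PX K"
      unfolding sample_law_def using that by (rule measurable_component_singleton)
    also have "?P \<rightarrow>\<^sub>M joint_law PX K = ?P \<rightarrow>\<^sub>M PX \<Otimes>\<^sub>M borel"
      by (intro measurable_cong_sets sets_joint_law K refl)
    finally show ?thesis
      by (rule measurable_compose[OF measurable_snd])
  qed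
  have map: "(\<lambda>w. f (fst w) \<tau> (fst (snd w i))) \<in> borel_measurable (S \<Otimes>\<^sub>M ?P)"
    if "i \<in> {1..m}" "\<tau> \<in> {\<alpha> / 2, 1 - \<alpha> / 2}" for i \<tau>
  proof -
    have "(\<lambda>w. (fst w, fst (snd w i))) \<in> S \<Otimes>\<^sub>M ?P \<rightarrow>\<^sub>M S \<Otimes>\<^sub>M PX"
      by (intro measurable_Pair measurable_fst measurable_compose[OF comp[OF that(1)] measurable_fst])
    from measurable_compose[OF this f[OF that(2)]] show ?thesis
      by simp
  qed
  have "(\<lambda>w. of_bool (cqr_score \<alpha> (f (fst w)) (fst (snd w i)) (snd (snd w i)) \<le> t) :: real)
      \<in> borel_measurable (S \<Otimes>\<^sub>M ?P)" if i: "i \<in> {1..m}" for i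
  proof -
    have [measurable]: "(\<lambda>w. snd (snd w i)) \<in> borel_measurable (S \<Otimes>\<^sub>M ?P)"
      by (rule measurable_compose[OF comp[OF i] measurable_snd])
    have [measurable]: "(\<lambda>w. f (fst w) (\<alpha> / 2) (fst (snd w i))) \<in> borel_measurable (S \<Otimes>\<^sub>M ?P)"
      "(\<lambda>w. f (fst w) (1 - \<alpha> / 2) (fst (snd w i))) \<in> borel_measurable (S \<Otimes>\<^sub>M ?P)"
      by (rule map[OF i]; simp)+
    show ?thesis
      unfolding cqr_score_def lower_endpoint_def upper_endpoint_def by measurable
  qed
  then show ?thesis
    unfolding empirical_score_cdf_def
    by (intro borel_measurable_divide borel_measurable_sum borel_measurable_const)
qed

theorem proposition1:
  fixes PX :: "'a measure" and K :: "'a \<Rightarrow> real measure"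
    and \<Omega> :: "'w measure" and Dtr Dcal :: "'w \<Rightarrow> nat \<Rightarrow> 'a \<times> real"
    and ft :: "nat \<Rightarrow> (nat \<Rightarrow> 'a \<times> real) \<Rightarrow> real \<Rightarrow> 'a \<Rightarrow> real"
    and \<epsilon> :: "nat \<Rightarrow> real \<Rightarrow> real" and p :: ennreal
    and \<alpha> \<delta> \<mu>low \<mu>up r0 :: real and n m :: nat
  assumes "prob_space PX"
    and "K \<in> PX \<rightarrow>\<^sub>M prob_algebra borel"
    and "0 < \<alpha>" "\<alpha> < 1" and "1 \<le> p"
    and "mass_regularity PX K \<alpha> \<mu>low \<mu>up r0"
    and "raw_maps_measurable PX K \<alpha> ft"
    and "endpoint_accuracy PX K \<alpha> p ft \<epsilon>"
    and "0 < \<delta>" "\<delta> < 1" and "1 \<le> n" "1 \<le> m"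
    and "prob_space \<Omega>"
    and "Dtr \<in> \<Omega> \<rightarrow>\<^sub>M sample_law PX K n"
    and "distr \<Omega> (sample_law PX K n) Dtr = sample_law PX K n"
    and "Dcal \<in> \<Omega> \<rightarrow>\<^sub>M sample_law PX K m"
    and "distr \<Omega> (sample_law PX K m) Dcal = sample_law PX K m"
    and "prob_space.indep_var \<Omega> (sample_law PX K n) Dtr (sample_law PX K m) Dcal"
    and "2 * \<mu>up * \<epsilon> n (\<delta>/4) + deviation_scale m \<delta>
           \<le> 2 * \<mu>low * min r0 ((1 - \<alpha>) / (2 * \<mu>up))"
    and "2 * \<mu>up * \<epsilon> n (\<delta>/4) + deviation_scale m \<delta> + level_excess \<alpha> m
           \<le> 2 * \<mu>low * r0"
  shows "\<exists>A \<in> sets (vimage_algebra (space \<Omega>) (\<lambda>\<omega>. (Dtr \<omega>, Dcal \<omega>))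
                     (sample_law PX K n \<Otimes>\<^sub>M sample_law PX K m)).
           measure \<Omega> A \<ge> 1 - \<delta> \<and>
           (\<forall>\<omega>\<in>A.
             \<bar>cqr_threshold \<alpha> (ft n (Dtr \<omega>)) m (Dcal \<omega>)\<bar> \<noteq> \<infinity> \<and>
             Lp_norm PX p
               (\<lambda>x. measure lborel (cqr_set \<alpha> (ft n (Dtr \<omega>)) m (Dcal \<omega>) x)
                     - measure lborel (oracle_interval K \<alpha> x))
             \<le> ennreal (2 * (1 + \<mu>up / \<mu>low) * \<epsilon> n (\<delta>/4)
                         + (deviation_scale m \<delta> + level_excess \<alpha> m) / \<mu>low))"
proof -
  note PX = assms(1) and K = assms(2) and \<alpha> = assms(3,4) and p = assms(5) and reg = assms(6)
    and n = assms(11) and m = assms(12)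
  note \<delta> = assms(9,10)
  interpret PX: prob_space PX by fact
  interpret \<Omega>: prob_space \<Omega> by fact
  let ?S = "sample_law PX K n" and ?T = "sample_law PX K m"
  have J: "prob_space (joint_law PX K)"
    using PX K by (rule prob_space_joint_law)
  interpret S: prob_space ?S
    unfolding sample_law_def using J by (intro prob_space_PiM)
  have T: "prob_space ?T"
    unfolding sample_law_def using J by (intro prob_space_PiM)
  define e where "e = \<epsilon> n (\<delta> / 4)"
  define \<eta> where "\<eta> = deviation_scale m \<delta>"
  define s where "s = level_excess \<alpha> m"
  define \<beta> where "\<beta> = cqr_level \<alpha> m"
  define ql where "ql = oracle_quantile K (\<alpha> / 2)"
  define qu where "qu = oracle_quantile K (1 - \<alpha> / 2)"
  have \<mu>: "0 < \<mu>low" "\<mu>low \<le> \<mu>up"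
    using reg by (auto simp: mass_regularity_def)
  have acc: "0 \<le> e \<and> (\<forall>\<tau>\<in>{\<alpha> / 2, 1 - \<alpha> / 2}. measure ?S {d \<in> space ?S.
      Lp_norm PX p (\<lambda>x. ft n d \<tau> x - oracle_quantile K \<tau> x) \<le> ennreal e} \<ge> 1 - \<delta> / 4)"
    using assms(8) n \<delta> unfolding endpoint_accuracy_def e_def by simp
  then have e: "0 \<le> e" by simp
  have \<eta>: "0 \<le> \<eta>"
    using \<delta> by (simp add: \<eta>_def deviation_scale_def)
  have \<beta>: "\<beta> = 1 - \<alpha> + s"
    by (simp add: \<beta>_def s_def level_excess_def)
  \<comment> \<open>The rounded level strictly exceeds $1 - \<alpha>$, so an empirical frequency of at most $1 - \<alpha>$ stays
    below it.\<close>
  have s: "0 < s"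
  proof -
    have "(1 - \<alpha>) * real m < (real m + 1) * (1 - \<alpha>)"
      using \<alpha> by (simp add: algebra_simps)
    also have "\<dots> \<le> real_of_int \<lceil>(real m + 1) * (1 - \<alpha>)\<rceil>"
      by (rule le_of_int_ceiling)
    finally show ?thesis
      using m by (simp add: s_def level_excess_def cqr_level_def field_simps)
  qed
  \<comment> \<open>The threshold is to lie in $[-a, b]$. These are the smallest offsets at which the gain
    $2 \<mu>_{low} a$ or $2 \<mu>_{low} b$ in coverage pays for the endpoint error, the sampling
    deviation and, on the upper side, the excess of the level.\<close>
  define a where "a = (2 * \<mu>up * e + \<eta>) / (2 * \<mu>low)"
  define b where "b = (2 * \<mu>up * e + \<eta> + s) / (2 * \<mu>low)"
  have a_eq: "2 * \<mu>low * a = 2 * \<mu>up * e + \<eta>" and b_eq: "2 * \<mu>low * b = 2 * \<mu>up * e + \<eta> + s"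
    using \<mu> by (simp_all add: a_def b_def)
  have ab: "0 \<le> a" "a \<le> b"
    using \<mu> e \<eta> s by (simp_all add: a_def b_def divide_right_mono)
  have a_le: "a \<le> r0" "2 * \<mu>up * a \<le> 1 - \<alpha>"
  proof -
    have "2 * \<mu>low * a \<le> 2 * \<mu>low * min r0 ((1 - \<alpha>) / (2 * \<mu>up))"
      using assms(19) by (simp add: a_eq e_def \<eta>_def)
    then have "a \<le> min r0 ((1 - \<alpha>) / (2 * \<mu>up))"
      using \<mu> by simp
    then show "a \<le> r0" "2 * \<mu>up * a \<le> 1 - \<alpha>"
      using \<mu> by (simp_all add: field_simps)
  qed
  have b_le: "b \<le> r0"
  proof -
    have "2 * \<mu>low * b \<le> 2 * \<mu>low * r0"
      using assms(20) by (simp add: b_eq e_def \<eta>_def s_def)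
    then show ?thesis
      using \<mu> by simp
  qed

  \<comment> \<open>These accuracy events are measurable because the accuracy hypothesis gives them positive measure,
    whereas a set outside the sigma-algebra has measure $0$.\<close>
  define H where "H = (\<lambda>\<tau>. {d \<in> space ?S.
    Lp_norm PX p (\<lambda>x. ft n d \<tau> x - oracle_quantile K \<tau> x) \<le> ennreal e})"
  have H: "H \<tau> \<in> sets ?S" "measure ?S (space ?S - H \<tau>) \<le> \<delta> / 4"
    if "\<tau> \<in> {\<alpha> / 2, 1 - \<alpha> / 2}" for \<tau>
  proof -
    have "1 - \<delta> / 4 \<le> measure ?S (H \<tau>)"
      unfolding H_def using acc that by blast
    moreover from this show "H \<tau> \<in> sets ?S"
      using \<delta> measure_notin_sets[of "H \<tau>" ?S] by force
    ultimately show "measure ?S (space ?S - H \<tau>) \<le> \<delta> / 4"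
      by (simp add: S.prob_compl)
  qed
  define G where "G = H (\<alpha> / 2) \<inter> H (1 - \<alpha> / 2)"
  have G: "G \<in> sets ?S"
    unfolding G_def using H(1) by auto
  have prob_G: "1 - \<delta> / 2 \<le> measure ?S G"
  proof -
    have "measure ?S (space ?S - G) \<le>
        measure ?S (space ?S - H (\<alpha> / 2)) + measure ?S (space ?S - H (1 - \<alpha> / 2))"
      unfolding G_def Diff_Int using H(1) by (intro measure_Un_le) auto
    also have "\<dots> \<le> \<delta> / 2"
      using H(2)[of "\<alpha> / 2"] H(2)[of "1 - \<alpha> / 2"] by simp
    finally show ?thesis
      using S.prob_compl[OF G] by simp
  qed

  have ft: "(\<lambda>(d, x). ft n d \<tau> x) \<in> borel_measurable (?S \<Otimes>\<^sub>M PX)"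
    if "\<tau> \<in> {\<alpha> / 2, 1 - \<alpha> / 2}" for \<tau>
    using assms(7) n that unfolding raw_maps_measurable_def by auto
  have ft_d: "ft n d \<tau> \<in> borel_measurable PX"
    if "d \<in> space ?S" "\<tau> \<in> {\<alpha> / 2, 1 - \<alpha> / 2}" for d \<tau>
    using measurable_compose[OF measurable_Pair1'[OF that(1)] ft[OF that(2)]] by simp

  define B where "B = {w \<in> space (?S \<Otimes>\<^sub>M ?T). fst w \<in> G \<and>
    empirical_score_cdf \<alpha> (ft n (fst w)) m (snd w) (- a) < \<beta> \<and>
    \<beta> \<le> empirical_score_cdf \<alpha> (ft n (fst w)) m (snd w) b}"
  have B: "B \<in> sets (?S \<Otimes>\<^sub>M ?T)"
  proof -
    have [measurable]: "(\<lambda>w. empirical_score_cdf \<alpha> (ft n (fst w)) m (snd w) t)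
        \<in> borel_measurable (?S \<Otimes>\<^sub>M ?T)" for t
      using PX K ft by (rule empirical_score_cdf_measurable)
    note G [measurable]
    show ?thesis
      unfolding B_def by measurable
  qed
  have calibrated: "1 - \<delta> / 2 \<le> measure ?T (Pair d -` B)" if d: "d \<in> G" for d
  proof -
    have ds: "d \<in> space ?S"
      using d G sets.sets_into_space by blast
    have err: "Lp_norm PX p (\<lambda>x. ft n d \<tau> x - oracle_quantile K \<tau> x) \<le> ennreal e"
      if "\<tau> \<in> {\<alpha> / 2, 1 - \<alpha> / 2}" for \<tau>
      using d that by (auto simp: G_def H_def)
    note L1 = PX.expectation_abs_le_Lp_norm[OF p e err]
    note bounds = score_cdf_bounds[OF PX K \<alpha> reg ft_d[OF ds] ft_d[OF ds] L1 L1]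
    have "1 - \<delta> / 2 \<le> measure ?T {D \<in> space ?T.
      empirical_score_cdf \<alpha> (ft n d) m D (- a) < \<beta> \<and> \<beta> \<le> empirical_score_cdf \<alpha> (ft n d) m D b}"
    proof (rule calibration_event[OF J m \<delta>])
      have "0 \<le> b"
        using ab by simp
      then show "\<beta> + deviation_scale m \<delta> \<le> measure (joint_law PX K)
          {z \<in> space (joint_law PX K). cqr_score \<alpha> (ft n d) (fst z) (snd z) \<le> b}"
        using bounds(2)[of b] b_le b_eq by (simp add: \<beta> \<eta>_def)
      show "measure (joint_law PX K)
          {z \<in> space (joint_law PX K). cqr_score \<alpha> (ft n d) (fst z) (snd z) \<le> - a}
          + deviation_scale m \<delta> \<le> \<beta>"
        using bounds(3)[of a] ab a_le a_eq s by (simp add: \<beta> \<eta>_def)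
      show "{z \<in> space (joint_law PX K). cqr_score \<alpha> (ft n d) (fst z) (snd z) \<le> t}
          \<in> sets (joint_law PX K)" for t
        using bounds(1)[of a] ab a_le by simp
    qed
    also have "{D \<in> space ?T. empirical_score_cdf \<alpha> (ft n d) m D (- a) < \<beta> \<and>
        \<beta> \<le> empirical_score_cdf \<alpha> (ft n d) m D b} = Pair d -` B"
      using ds d by (auto simp: B_def space_pair_measure)
    finally show ?thesis .
  qed
  have prob_B: "1 - \<delta> \<le> measure (?S \<Otimes>\<^sub>M ?T) B"
    using measure_pair_ge[OF S.prob_space_axioms T B G prob_G calibrated] \<delta> by simp

  let ?D = "\<lambda>\<omega>. (Dtr \<omega>, Dcal \<omega>)"
  define A where "A = ?D -` B \<inter> space \<Omega>"
  have D: "?D \<in> \<Omega> \<rightarrow>\<^sub>M ?S \<Otimes>\<^sub>M ?T"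
    using assms(14,16) by (rule measurable_Pair)
  have "distr \<Omega> (?S \<Otimes>\<^sub>M ?T) ?D = ?S \<Otimes>\<^sub>M ?T"
    using assms(15,17,18) \<Omega>.indep_var_distribution_eq[of ?S Dtr ?T Dcal] by simp
  then have "measure \<Omega> A = measure (?S \<Otimes>\<^sub>M ?T) B"
    using measure_distr[OF D B] by (simp add: A_def)
  with prob_B have prob_A: "1 - \<delta> \<le> measure \<Omega> A"
    by simp
  have A_sets: "A \<in> sets (vimage_algebra (space \<Omega>) ?D (?S \<Otimes>\<^sub>M ?T))"
    unfolding A_def using B by (rule in_vimage_algebra)

  have good: "\<bar>cqr_threshold \<alpha> (ft n (Dtr \<omega>)) m (Dcal \<omega>)\<bar> \<noteq> \<infinity> \<and>
      Lp_norm PX p (\<lambda>x. measure lborel (cqr_set \<alpha> (ft n (Dtr \<omega>)) m (Dcal \<omega>) x)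
        - measure lborel (oracle_interval K \<alpha> x))
      \<le> ennreal (2 * (1 + \<mu>up / \<mu>low) * e + (\<eta> + s) / \<mu>low)" if "\<omega> \<in> A" for \<omega>
  proof -
    let ?g = "ft n (Dtr \<omega>)"
    have d: "Dtr \<omega> \<in> G" and F: "empirical_score_cdf \<alpha> ?g m (Dcal \<omega>) (- a) < \<beta>"
        "\<beta> \<le> empirical_score_cdf \<alpha> ?g m (Dcal \<omega>) b"
      using that by (auto simp: A_def B_def)
    have ds: "Dtr \<omega> \<in> space ?S"
      using d G sets.sets_into_space by blast
    obtain Q where Q: "cqr_threshold \<alpha> ?g m (Dcal \<omega>) = ereal Q" "- a \<le> Q" "Q \<le> b"
      using gen_inverse_between[OF mono_empirical_score_cdf F] unfolding cqr_threshold_def \<beta>_def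
      by blast
    have err: "Lp_norm PX p (\<lambda>x. ?g \<tau> x - oracle_quantile K \<tau> x) \<le> ennreal e"
      if "\<tau> \<in> {\<alpha> / 2, 1 - \<alpha> / 2}" for \<tau>
      using d that by (auto simp: G_def H_def)
    \<comment> \<open>A finite norm includes measurability, so the oracle quantile is measurable as the difference
      of the raw map and its error.\<close>
    have q_meas: "oracle_quantile K \<tau> \<in> borel_measurable PX" if \<tau>: "\<tau> \<in> {\<alpha> / 2, 1 - \<alpha> / 2}" for \<tau>
    proof -
      have "(\<lambda>x. ?g \<tau> x - oracle_quantile K \<tau> x) \<in> borel_measurable PX"
        using PX.expectation_abs_le_Lp_norm(1)[OF p e err[OF \<tau>]] by (rule borel_measurable_integrable)
      from borel_measurable_diff[OF ft_d[OF ds \<tau>] this] show ?thesis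
        by simp
    qed
    have "oracle_quantile K (\<alpha> / 2) x \<le> oracle_quantile K (1 - \<alpha> / 2) x" if "x \<in> space PX" for x
      using kernel_real_distribution[OF K that] \<alpha> by (intro oracle_quantile_mono) auto
    then have "Lp_norm PX p (\<lambda>x. max 0 (upper_endpoint \<alpha> ?g x - lower_endpoint \<alpha> ?g x + 2 * Q)
        - max 0 (oracle_quantile K (1 - \<alpha> / 2) x - oracle_quantile K (\<alpha> / 2) x))
      \<le> ennreal (2 * e + 2 * b)"
      using Q ab by (intro PX.length_error_Lp[OF p e] err q_meas ft_d ds) auto
    also have "2 * e + 2 * b = 2 * (1 + \<mu>up / \<mu>low) * e + (\<eta> + s) / \<mu>low"
      using \<mu> by (simp add: b_def field_simps)
    finally show ?thesis
      unfolding length_cqr_set[OF Q(1)] oracle_interval_def measure_lborel_Icc_max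
      using Q(1) by simp
  qed
  show ?thesis
    using A_sets prob_A good[unfolded e_def \<eta>_def s_def] by (intro bexI[of _ A] conjI ballI) simp_all
qed

end
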